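(* Let $(X,d)$ be a complete controlled rectangular metric space with control function $\alpha: X\times X\to[1,+\infty[$, and let $T:X\to X$ be a self-mapping. Suppose there exists $k$ with $0<k<\frac12$ such that for all $x,y\in X$, $$d(Tx,Ty)\leq k\left[d(x,Tx)+d(y,Ty)\right].$$ Let $x_0\in X$ and put $x_n=T^n x_0$ for $n\in\mathbb{N}$. Suppose that $$\sup_{m\geq 1}\ \lim_{i\to\infty}\ \alpha(x_{i+1},x_m)\,\frac{\alpha(x_{i+1},x_{i+2})+\alpha(x_{i+2},x_{i+3})}{\alpha(x_i,x_{i+1})+\alpha(x_{i+1},x_{i+2})}<\frac{1}{k^2}.$$ Assume moreover that for every $x\in X$ the limits $$\lim_{n\to+\infty}\alpha(x_n,x),\qquad \lim_{n\to+\infty}\alpha(x,x_n),\qquad \lim_{n,m\to+\infty,\ n\neq m}\alpha(x_n,x_m)$$ exist and are finite, and that for every $x\in X$ $$\lim_{n\to+\infty}\alpha(Tx_n,Tx)<\frac1k.$$ Then $T$ has a unique fixed point in $X$.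
   Context: Let $X$ be a non-empty set and $\alpha:X\times X\to[1,+\infty[$ a function. A function $d:X\times X\to[0,+\infty[$ is called a controlled rectangular metric (with control function $\alpha$), and $(X,d)$ a controlled rectangular metric space, if: ($d_1$) for all $x,y\in X$, $d(x,y)=0$ if and only if $x=y$; ($d_2$) for all $x,y\in X$, $d(x,y)=d(y,x)$; ($d_3$) for all pairwise distinct $x,y,u,v\in X$, $d(x,y)\leq\alpha(x,u)d(x,u)+\alpha(u,v)d(u,v)+\alpha(v,y)d(v,y)$. (The function $\alpha$ is not assumed symmetric.) A sequence $\{x_n\}$ in $X$ converges to $x\in X$ if $\lim_{n\to\infty}d(x_n,x)=0$; it is Cauchy if for every $\varepsilon>0$ there is a positive integer $N$ such that $d(x_n,x_m)<\varepsilon$ for all $n,m\geq N$. The space $(X,d)$ is complete if every Cauchy sequence in $X$ converges to some point of $X$. *)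

theory Defs
  imports Complex_Main "HOL-Library.FuncSet" "HOL-Library.Extended_Real"
begin

text \<open>The space is a carrier set \<open>X\<close>; values of \<open>\<alpha>\<close> and \<open>d\<close> outside \<open>X \<times> X\<close> are
  irrelevant. The control function \<open>\<alpha>\<close> is not assumed symmetric.\<close>

definition controlled_rectangular_metric ::
    "'a set \<Rightarrow> ('a \<Rightarrow> 'a \<Rightarrow> real) \<Rightarrow> ('a \<Rightarrow> 'a \<Rightarrow> real) \<Rightarrow> bool" where
  "controlled_rectangular_metric X \<alpha> d \<longleftrightarrow>
     X \<noteq> {} \<and>
     (\<forall>x\<in>X. \<forall>y\<in>X. 1 \<le> \<alpha> x y) \<and>
     (\<forall>x\<in>X. \<forall>y\<in>X. 0 \<le> d x y) \<and>
     (\<forall>x\<in>X. \<forall>y\<in>X. d x y = 0 \<longleftrightarrow> x = y) \<and>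
     (\<forall>x\<in>X. \<forall>y\<in>X. d x y = d y x) \<and>
     (\<forall>x\<in>X. \<forall>y\<in>X. \<forall>u\<in>X. \<forall>v\<in>X. distinct [x, y, u, v] \<longrightarrow>
        d x y \<le> \<alpha> x u * d x u + \<alpha> u v * d u v + \<alpha> v y * d v y)"

definition converges_to :: "('a \<Rightarrow> 'a \<Rightarrow> real) \<Rightarrow> (nat \<Rightarrow> 'a) \<Rightarrow> 'a \<Rightarrow> bool" where
  "converges_to d s x \<longleftrightarrow> (\<lambda>n. d (s n) x) \<longlonglongrightarrow> 0"

definition cauchy_seq :: "('a \<Rightarrow> 'a \<Rightarrow> real) \<Rightarrow> (nat \<Rightarrow> 'a) \<Rightarrow> bool" where
  "cauchy_seq d s \<longleftrightarrow> (\<forall>\<epsilon>>0. \<exists>N>0. \<forall>n\<ge>N. \<forall>m\<ge>N. d (s n) (s m) < \<epsilon>)"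

definition complete_space :: "'a set \<Rightarrow> ('a \<Rightarrow> 'a \<Rightarrow> real) \<Rightarrow> bool" where
  "complete_space X d \<longleftrightarrow>
     (\<forall>s. (\<forall>n. s n \<in> X) \<and> cauchy_seq d s \<longrightarrow> (\<exists>x\<in>X. converges_to d s x))"

text \<open>Joint limit \<open>n, m \<rightarrow> \<infinity>\<close> restricted to index pairs with \<open>n \<noteq> m\<close>.\<close>

definition offdiag_at_infinity :: "(nat \<times> nat) filter" where
  "offdiag_at_infinity = inf (sequentially \<times>\<^sub>F sequentially) (principal {(n, m). n \<noteq> m})"

end

theory Submission
  imports Defs
begin

text \<open>
  The proof is the classical one for Kannan maps. Comparing two consecutive points of an orbit,
  the contraction condition bounds the gap \<open>d (T y) (T (T y))\<close> by \<open>k / (1 - k)\<close> times the gap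
  \<open>d y (T y)\<close>, and \<open>k / (1 - k) < 1\<close> because \<open>k < 1 / 2\<close>; so the gaps of an orbit tend to \<open>0\<close>
  (\<open>orbit_gap_tendsto_0\<close>). The condition then bounds the distance of \<^emph>\<open>any\<close> two points of the orbit
  by the sum of the gaps before them, so no chain of points has to be summed up and the orbit is
  Cauchy (\<open>orbit_cauchy\<close>).

  That the limit \<open>z\<close> of the orbit is fixed comes from the rectangle inequality
  (\<open>orbit_limit_is_fixed\<close>). On the path from \<open>z\<close> over \<open>x\<^sub>n\<close> and \<open>x\<^sub>n\<^sub>+\<^sub>1\<close> to \<open>T z\<close> the first
  two edges become negligible, while the last one is at most about \<open>k * d z (T z)\<close> and carries a
  coefficient whose limit is below \<open>1 / k\<close>. So a positive \<open>d z (T z)\<close> would be smaller than itself.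
\<close>

text \<open>The contraction condition compares two points through their gaps, not through a path between
  them, so the orbits can be studied for a \<open>d\<close> without any form of triangle inequality. The
  rectangle inequality is added in the one lemma that walks along a path.\<close>

locale kannan_map =
  fixes X :: "'a set" and d :: "'a \<Rightarrow> 'a \<Rightarrow> real" and T :: "'a \<Rightarrow> 'a" and k :: real
  assumes nonneg: "\<lbrakk>y \<in> X; z \<in> X\<rbrakk> \<Longrightarrow> 0 \<le> d y z"
    and zero_iff: "\<lbrakk>y \<in> X; z \<in> X\<rbrakk> \<Longrightarrow> d y z = 0 \<longleftrightarrow> y = z"
    and sym: "\<lbrakk>y \<in> X; z \<in> X\<rbrakk> \<Longrightarrow> d y z = d z y"
    and maps_into: "y \<in> X \<Longrightarrow> T y \<in> X"
    and k_pos: "0 < k" and k_less_half: "k < 1 / 2"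
    and kannan: "\<lbrakk>y \<in> X; z \<in> X\<rbrakk> \<Longrightarrow> d (T y) (T z) \<le> k * (d y (T y) + d z (T z))"
begin

lemma orbit_in: "y \<in> X \<Longrightarrow> (T ^^ n) y \<in> X"
  by (induction n) (auto intro: maps_into)

text \<open>The gap at \<open>T y\<close> occurs on both sides of the contraction condition for \<open>y\<close> and \<open>T y\<close>;
  solving for it produces the factor \<open>k / (1 - k)\<close>.\<close>

lemma gap_contracts:
  assumes "y \<in> X"
  shows "d (T y) (T (T y)) \<le> k / (1 - k) * d y (T y)"
proof -
  have "(1 - k) * d (T y) (T (T y)) \<le> k * d y (T y)"
    using kannan[OF assms maps_into[OF assms]] by (simp add: algebra_simps)
  then show ?thesis
    using k_less_half by (simp add: field_simps)
qed

lemma orbit_gap_tendsto_0: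
  assumes "y \<in> X"
  shows "(\<lambda>n. d ((T ^^ n) y) ((T ^^ Suc n) y)) \<longlonglongrightarrow> 0"
proof -
  let ?r = "k / (1 - k)"
  have r: "0 \<le> ?r" "?r < 1"
    using k_pos k_less_half by (auto simp: field_simps)
  have bound: "d ((T ^^ n) y) ((T ^^ Suc n) y) \<le> ?r ^ n * d y (T y)" for n
  proof (induction n)
    case (Suc n)
    have "d ((T ^^ Suc n) y) ((T ^^ Suc (Suc n)) y) \<le> ?r * d ((T ^^ n) y) ((T ^^ Suc n) y)"
      using gap_contracts[OF orbit_in[OF assms, of n]] by simp
    also have "\<dots> \<le> ?r * (?r ^ n * d y (T y))"
      using Suc.IH r(1) by (rule mult_left_mono)
    finally show ?case
      by (simp add: mult.assoc)
  qed simp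
  have "(\<lambda>n. ?r ^ n * d y (T y)) \<longlonglongrightarrow> 0"
    using r by (intro tendsto_mult_left_zero LIMSEQ_realpow_zero)
  with always_eventually always_eventually tendsto_const show ?thesis
    by (rule tendsto_sandwich) (intro allI bound nonneg orbit_in assms)+
qed

text \<open>Two orbit points \<open>T a\<close> and \<open>T b\<close> are at most \<open>k\<close> times the sum of the gaps at \<open>a\<close> and \<open>b\<close>
  apart, so small gaps make all late orbit points close to each other.\<close>

lemma orbit_cauchy:
  assumes "y \<in> X"
  shows "cauchy_seq d (\<lambda>n. (T ^^ n) y)"
  unfolding cauchy_seq_def
proof (intro allI impI)
  fix e :: real
  assume "0 < e"
  then have "\<forall>\<^sub>F n in sequentially. d ((T ^^ n) y) ((T ^^ Suc n) y) < e"
    using orbit_gap_tendsto_0[OF assms] by (rule order_tendstoD(2)[rotated])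
  then obtain N where N: "\<And>n. N \<le> n \<Longrightarrow> d ((T ^^ n) y) ((T ^^ Suc n) y) < e"
    by (auto simp: eventually_sequentially)
  have "d ((T ^^ n) y) ((T ^^ m) y) < e" if ge: "Suc N \<le> n" "Suc N \<le> m" for n m
  proof -
    obtain i j where ij: "n = Suc i" "m = Suc j" "N \<le> i" "N \<le> j"
      using ge by (cases n; cases m) auto
    have "d ((T ^^ n) y) ((T ^^ m) y)
        \<le> k * (d ((T ^^ i) y) ((T ^^ Suc i) y) + d ((T ^^ j) y) ((T ^^ Suc j) y))"
      using kannan[OF orbit_in[OF assms, of i] orbit_in[OF assms, of j]] ij by simp
    also have "\<dots> < k * (e + e)"
      using N[OF ij(3)] N[OF ij(4)] k_pos by (intro mult_strict_left_mono) auto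
    also have "\<dots> < e"
      using k_less_half \<open>0 < e\<close> by (simp add: algebra_simps)
    finally show ?thesis .
  qed
  then show "\<exists>N>0. \<forall>n\<ge>N. \<forall>m\<ge>N. d ((T ^^ n) y) ((T ^^ m) y) < e"
    by blast
qed

lemma fixed_point_unique:
  assumes "y \<in> X" "T y = y" "z \<in> X" "T z = z"
  shows "y = z"
proof -
  have "d y y = 0" "d z z = 0"
    using assms zero_iff by auto
  then have "d y z \<le> 0"
    using kannan[OF assms(1,3)] assms by simp
  then show ?thesis
    using nonneg zero_iff assms by (metis order_antisym)
qed

text \<open>If \<open>T z \<noteq> z\<close>, the points \<open>z\<close>, \<open>x\<^sub>n\<close>, \<open>x\<^sub>n\<^sub>+\<^sub>1\<close> and \<open>T z\<close>, where \<open>x\<^sub>n = (T ^^ n) y\<close>, have to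
  be distinct before the rectangle inequality applies. For arbitrarily late \<open>n\<close> this fails only if
  the orbit has become constant, hence equal to its limit \<open>z\<close>, or if it returns again and again to
  \<open>T z\<close> (each visit to \<open>z\<close> is followed by one to \<open>T z\<close>). The first makes \<open>z\<close> a fixed point, the
  second contradicts \<open>d z (T z) > 0\<close> because the orbit converges to \<open>z\<close>.\<close>

lemma orbit_limit_is_fixed:
  assumes rect: "\<And>p q u v. \<lbrakk>p \<in> X; q \<in> X; u \<in> X; v \<in> X; distinct [p, q, u, v]\<rbrakk> \<Longrightarrow>
      d p q \<le> \<alpha> p u * d p u + \<alpha> u v * d u v + \<alpha> v q * d v q"
    and \<alpha>_nonneg: "\<And>p q. \<lbrakk>p \<in> X; q \<in> X\<rbrakk> \<Longrightarrow> 0 \<le> \<alpha> p q"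
    and y: "y \<in> X" and z: "z \<in> X"
    and lim: "converges_to d (\<lambda>n. (T ^^ n) y) z"
    and first: "convergent (\<lambda>n. \<alpha> z ((T ^^ n) y))"
    and middle: "convergent (\<lambda>n. \<alpha> ((T ^^ n) y) ((T ^^ Suc n) y))"
    and last: "(\<lambda>n. \<alpha> ((T ^^ Suc n) y) (T z)) \<longlonglongrightarrow> c" "c < 1 / k"
  shows "T z = z"
proof (rule ccontr)
  assume no_fix: "T z \<noteq> z"
  define s where "s n = (T ^^ n) y" for n
  have s: "s n \<in> X" for n
    unfolding s_def using y by (rule orbit_in)
  have s_Suc: "s (Suc n) = T (s n)" for n
    by (simp add: s_def)
  have Tz: "T z \<in> X"
    using z by (rule maps_into)
  let ?D = "d z (T z)"
  have D_pos: "0 < ?D"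
    using nonneg[OF z Tz] zero_iff[OF z Tz] no_fix by (metis less_eq_real_def)
  have lim': "(\<lambda>n. d (s n) z) \<longlonglongrightarrow> 0"
    using lim by (simp add: converges_to_def s_def)
  have gap: "(\<lambda>n. d (s n) (s (Suc n))) \<longlonglongrightarrow> 0"
    unfolding s_def using y by (rule orbit_gap_tendsto_0)

  have moves: "s n \<noteq> s (Suc n)" for n
  proof
    assume "s n = s (Suc n)"
    then have fixed: "T (s n) = s n"
      by (simp add: s_Suc)
    have "s (m + n) = s n" for m
      by (induction m) (simp_all add: s_Suc fixed)
    then have "(\<lambda>m. d (s n) z) \<longlonglongrightarrow> 0"
      using LIMSEQ_ignore_initial_segment[OF lim', of n] by simp
    then have "s n = z"
      using zero_iff[OF s z] by (simp add: LIMSEQ_const_iff)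
    then show False
      using fixed no_fix by simp
  qed
  have "\<forall>\<^sub>F n in sequentially. d (s n) z < ?D"
    using lim' D_pos by (rule order_tendstoD(2))
  then have ne_Tz: "\<forall>\<^sub>F n in sequentially. s n \<noteq> T z"
    by eventually_elim (use sym[OF z Tz] in auto)
  then have ne_Tz_Suc: "\<forall>\<^sub>F n in sequentially. s (Suc n) \<noteq> T z"
    by (rule eventually_compose_filterlim[OF _ filterlim_Suc])
  have ne_z: "\<forall>\<^sub>F n in sequentially. s n \<noteq> z"
    using ne_Tz_Suc by eventually_elim (auto simp: s_Suc)
  have ne_z_Suc: "\<forall>\<^sub>F n in sequentially. s (Suc n) \<noteq> z"
    using ne_z by (rule eventually_compose_filterlim[OF _ filterlim_Suc])

  let ?B = "\<lambda>n. \<alpha> z (s n) * d z (s n) + \<alpha> (s n) (s (Suc n)) * d (s n) (s (Suc n)) +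
    \<alpha> (s (Suc n)) (T z) * (k * (d (s n) (s (Suc n)) + ?D))"
  have bound: "\<forall>\<^sub>F n in sequentially. ?D \<le> ?B n"
    using ne_Tz ne_Tz_Suc ne_z ne_z_Suc
  proof eventually_elim
    case (elim n)
    then have "distinct [z, T z, s n, s (Suc n)]"
      using moves[of n] no_fix by auto
    then have "?D \<le> \<alpha> z (s n) * d z (s n) + \<alpha> (s n) (s (Suc n)) * d (s n) (s (Suc n)) +
        \<alpha> (s (Suc n)) (T z) * d (s (Suc n)) (T z)"
      by (rule rect[OF z Tz s s])
    moreover have "\<alpha> (s (Suc n)) (T z) * d (s (Suc n)) (T z)
        \<le> \<alpha> (s (Suc n)) (T z) * (k * (d (s n) (s (Suc n)) + ?D))"
      using kannan[OF s[of n] z] by (intro mult_left_mono \<alpha>_nonneg s Tz) (simp add: s_Suc)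
    ultimately show ?case
      by linarith
  qed

  obtain a where a: "(\<lambda>n. \<alpha> z (s n)) \<longlonglongrightarrow> a"
    using first by (auto simp: convergent_def s_def)
  obtain b where b: "(\<lambda>n. \<alpha> (s n) (s (Suc n))) \<longlonglongrightarrow> b"
    using middle by (auto simp: convergent_def s_def)
  have "(\<lambda>n. d z (s n)) \<longlonglongrightarrow> 0"
    using lim' by (simp add: sym[OF z s])
  then have "?B \<longlonglongrightarrow> a * 0 + b * 0 + c * (k * (0 + ?D))"
    using a b gap last(1) unfolding s_def by (intro tendsto_intros)
  then have "?D \<le> a * 0 + b * 0 + c * (k * (0 + ?D))"
    using bound by (intro tendsto_lowerbound[OF _ bound]) auto
  then have "?D \<le> (c * k) * ?D"
    by simp
  moreover have "(c * k) * ?D < 1 * ?D"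
    using last(2) k_pos D_pos by (intro mult_strict_right_mono) (auto simp: field_simps)
  ultimately show False
    by simp
qed

end

text \<open>Consecutive indices are off the diagonal, so a double limit over distinct indices
  contains the limit along pairs of successive terms.\<close>

lemma filterlim_successive_offdiag: "filterlim (\<lambda>n. (n, Suc n)) offdiag_at_infinity sequentially"
  unfolding offdiag_at_infinity_def
  by (auto simp: filterlim_inf filterlim_principal intro!: filterlim_Pair filterlim_ident filterlim_Suc)

theorem theorem2p8:
  fixes X :: "'a set" and \<alpha> d :: "'a \<Rightarrow> 'a \<Rightarrow> real" and T :: "'a \<Rightarrow> 'a"
    and k :: real and x\<^sub>0 :: 'a and x :: "nat \<Rightarrow> 'a"
  assumes "controlled_rectangular_metric X \<alpha> d"
    and "complete_space X d"
    and "T \<in> X \<rightarrow> X"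
    and "0 < k" and "k < 1 / 2"
    and "\<forall>y\<in>X. \<forall>z\<in>X. d (T y) (T z) \<le> k * (d y (T y) + d z (T z))"
    and "x\<^sub>0 \<in> X"
    and "\<forall>n. x n = (T ^^ n) x\<^sub>0"
    and "\<forall>m\<ge>1. convergent (\<lambda>i. ereal (\<alpha> (x (i+1)) (x m) *
           ((\<alpha> (x (i+1)) (x (i+2)) + \<alpha> (x (i+2)) (x (i+3))) /
            (\<alpha> (x i) (x (i+1)) + \<alpha> (x (i+1)) (x (i+2))))))"
    and "(SUP m\<in>{1..}. lim (\<lambda>i. ereal (\<alpha> (x (i+1)) (x m) *
           ((\<alpha> (x (i+1)) (x (i+2)) + \<alpha> (x (i+2)) (x (i+3))) /
            (\<alpha> (x i) (x (i+1)) + \<alpha> (x (i+1)) (x (i+2))))))) < ereal (1 / k\<^sup>2)"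
    and "\<forall>z\<in>X. convergent (\<lambda>n. \<alpha> (x n) z)"
    and "\<forall>z\<in>X. convergent (\<lambda>n. \<alpha> z (x n))"
    and "\<exists>L. ((\<lambda>(n, m). \<alpha> (x n) (x m)) \<longlongrightarrow> L) offdiag_at_infinity"
    and "\<forall>z\<in>X. convergent (\<lambda>n. \<alpha> (T (x n)) (T z)) \<and> lim (\<lambda>n. \<alpha> (T (x n)) (T z)) < 1 / k"
  shows "\<exists>!z. z \<in> X \<and> T z = z"
proof -
  have T: "T y \<in> X" if "y \<in> X" for y
    using assms(3) that by auto
  interpret kannan_map X d T k
    by unfold_locales
      (use assms(1) T assms(4-6) in \<open>auto simp: controlled_rectangular_metric_def\<close>)
  have \<alpha>_nonneg: "0 \<le> \<alpha> p q" if "p \<in> X" "q \<in> X" for p q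
  proof -
    have "1 \<le> \<alpha> p q"
      using assms(1) that unfolding controlled_rectangular_metric_def by blast
    then show ?thesis
      by simp
  qed
  have rect: "d p q \<le> \<alpha> p u * d p u + \<alpha> u v * d u v + \<alpha> v q * d v q"
    if "p \<in> X" "q \<in> X" "u \<in> X" "v \<in> X" "distinct [p, q, u, v]" for p q u v
    using assms(1) that unfolding controlled_rectangular_metric_def by blast
  have x: "x = (\<lambda>n. (T ^^ n) x\<^sub>0)"
    using assms(8) by auto
  have x_Suc: "x (Suc n) = T (x n)" for n
    by (simp add: x)
  have "cauchy_seq d x"
    unfolding x using assms(7) by (rule orbit_cauchy)
  moreover have "\<forall>n. x n \<in> X"
    unfolding x using orbit_in[OF assms(7)] by blast
  ultimately obtain z where z: "z \<in> X" "converges_to d x z"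
    using assms(2) unfolding complete_space_def by blast
  obtain L where "((\<lambda>(n, m). \<alpha> (x n) (x m)) \<longlongrightarrow> L) offdiag_at_infinity"
    using assms(13) by blast
  then have "(\<lambda>n. \<alpha> (x n) (x (Suc n))) \<longlonglongrightarrow> L"
    using filterlim_compose[OF _ filterlim_successive_offdiag] by fastforce
  then have middle: "convergent (\<lambda>n. \<alpha> (x n) (x (Suc n)))"
    by (rule convergentI)
  have last: "(\<lambda>n. \<alpha> (x (Suc n)) (T z)) \<longlonglongrightarrow> lim (\<lambda>n. \<alpha> (T (x n)) (T z))"
    "lim (\<lambda>n. \<alpha> (T (x n)) (T z)) < 1 / k"
    using assms(14) z(1) by (auto simp: x_Suc convergent_LIMSEQ_iff)
  have "T z = z"
    using orbit_limit_is_fixed[where y = x\<^sub>0, OF rect \<alpha>_nonneg assms(7) z(1)] z middle last assms(12)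
    unfolding x by blast
  then show ?thesis
    using z(1) fixed_point_unique by blast
qed

end
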